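(* Let $f:[0,1]\to\mathbb{R}$ be $L_f$-Lipschitz, let $t[1]<\dots<t[I]$ be the uniform grid on $[0,1]$ with $I$ points, and let $x^*\in\mathbb{R}^I$ be the discretization $x^*[i]=f(t[i])$. Let $x\in\mathbb{R}^I$ and let $\hat f_x$ be the corresponding piecewise linear function. Let $\epsilon>0$, $C=\sqrt{\tfrac{8}{15}}\,L_f$ and $D=L_f/\sqrt{30}$. If $$I > C\epsilon^{-1}+1\qquad\text{and}\qquad \lVert x-x^*\rVert_2^2< D\epsilon,$$ then $$\lVert \hat f_x-f\rVert_2<\epsilon .$$
   Context: The uniform grid is $t[i]=\frac{i-1}{I-1}$, with spacing $\Delta t=\frac1{I-1}$. The piecewise linear function constructed from $x\in\mathbb{R}^I$ is $\hat f_x(t)=\frac{x[i+1]-x[i]}{t[i+1]-t[i]}(t-t[i])+x[i]$ for $t[i]\le t\le t[i+1]$, $i=1,\dots,I-1$. For vectors $\lVert\cdot\rVert_2$ is the Euclidean norm; for functions it is the $L^2([0,1])$ norm. *)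

theory Defs
  imports "HOL-Analysis.Analysis"
begin

text \<open>
  A vector of \<open>\<real>\<^sup>I\<close> is represented by a function on \<^typ>\<open>nat\<close> of which only the entries with
  index in \<open>{1..I}\<close> matter; its Euclidean norm is \<open>L2_set x {1..I}\<close>.
\<close>

definition grid :: "nat \<Rightarrow> nat \<Rightarrow> real" where
  "grid I i = (real i - 1) / (real I - 1)"

definition pw_linear :: "nat \<Rightarrow> (nat \<Rightarrow> real) \<Rightarrow> real \<Rightarrow> real" where
  "pw_linear I x t = (THE y. \<exists>i\<in>{1..<I}. grid I i \<le> t \<and> t \<le> grid I (i + 1) \<and>
     y = (x (i + 1) - x i) / (grid I (i + 1) - grid I i) * (t - grid I i) + x i)"

text \<open>
  Meaningful if \<open>g\<close> is square integrable on \<open>[0,1]\<close> (otherwise the Bochner integral is \<open>0\<close> by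
  convention); lemma \<open>integrable_pw_linear_diff\<close> below shows that this is so for the functions to
  which the norm is applied.
\<close>

definition L2_norm01 :: "(real \<Rightarrow> real) \<Rightarrow> real" where
  "L2_norm01 g = sqrt (LINT t:{0..1}|lborel. (g t)\<^sup>2)"

lemma grid_less_iff:
  assumes "2 \<le> I"
  shows "grid I i < grid I j \<longleftrightarrow> i < j"
  using assms by (simp add: grid_def divide_less_cancel)

lemma grid_le_iff:
  assumes "2 \<le> I"
  shows "grid I i \<le> grid I j \<longleftrightarrow> i \<le> j"
  using assms by (simp add: grid_def divide_le_cancel)

lemma pw_linear_eq:
  assumes I: "2 \<le> I" and i: "i \<in> {1..<I}"
    and t: "grid I i \<le> t" "t \<le> grid I (i + 1)"
  shows "pw_linear I x t =
    (x (i + 1) - x i) / (grid I (i + 1) - grid I i) * (t - grid I i) + x i"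
  unfolding pw_linear_def
proof (rule the_equality)
  show "\<exists>j\<in>{1..<I}. grid I j \<le> t \<and> t \<le> grid I (j + 1) \<and>
      (x (i + 1) - x i) / (grid I (i + 1) - grid I i) * (t - grid I i) + x i =
      (x (j + 1) - x j) / (grid I (j + 1) - grid I j) * (t - grid I j) + x j"
    using i t by blast
next
  fix y
  assume "\<exists>j\<in>{1..<I}. grid I j \<le> t \<and> t \<le> grid I (j + 1) \<and>
      y = (x (j + 1) - x j) / (grid I (j + 1) - grid I j) * (t - grid I j) + x j"
  then obtain j where tj: "grid I j \<le> t" "t \<le> grid I (j + 1)"
    and y: "y = (x (j + 1) - x j) / (grid I (j + 1) - grid I j) * (t - grid I j) + x j"
    by blast
  have "grid I i \<le> grid I (j + 1)" "grid I j \<le> grid I (i + 1)"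
    using t tj by linarith+
  then have "i \<le> j + 1" "j \<le> i + 1"
    using grid_le_iff[OF I] by blast+
  then consider "j = i" | "j = i + 1" | "i = j + 1"
    by linarith
  then show "y = (x (i + 1) - x i) / (grid I (i + 1) - grid I i) * (t - grid I i) + x i"
  proof cases
    case 1
    then show ?thesis using y by simp
  next
    case 2
    then have eq: "t = grid I (i + 1)"
      using t tj by simp
    have "grid I i < grid I (i + 1)"
      using grid_less_iff[OF I] by simp
    then show ?thesis
      using y eq 2 by simp
  next
    case 3
    then have eq: "t = grid I (j + 1)"
      using t tj by simp
    have "grid I j < grid I (j + 1)"
      using grid_less_iff[OF I] by simp
    then show ?thesis
      using y eq 3 by simp
  qed
qed

lemma grid_cover:
  assumes I: "2 \<le> I"
  shows "(\<Union>i\<in>{1..<I}. {grid I i..grid I (i + 1)}) = {0..1}"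
proof -
  have "(\<Union>i\<in>{1..<Suc n}. {grid I i..grid I (i + 1)}) = {0..grid I (Suc n)}" if "1 \<le> n" for n
    using that
  proof (induction n rule: dec_induct)
    case base
    show ?case by (simp add: grid_def)
  next
    case (step n)
    have "{0..grid I (Suc n)} \<union> {grid I (Suc n)..grid I (Suc (Suc n))} = {0..grid I (Suc (Suc n))}"
      using grid_le_iff[OF I, of 1 "Suc n"] grid_le_iff[OF I, of "Suc n" "Suc (Suc n)"]
      by (intro ivl_disj_un_two_touch) (auto simp: grid_def)
    then show ?case
      using step by (simp add: atLeastLessThanSuc Un_commute)
  qed
  from this[of "I - 1"] I show ?thesis
    by (simp add: grid_def)
qed

lemma continuous_on_pw_linear:
  assumes I: "2 \<le> I"
  shows "continuous_on {0..1} (pw_linear I x)"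
proof -
  have "continuous_on (\<Union>i\<in>{1..<I}. {grid I i..grid I (i + 1)}) (pw_linear I x)"
  proof (rule continuous_on_closed_Union)
    fix i assume i: "i \<in> {1..<I}"
    have "continuous_on {grid I i..grid I (i + 1)}
        (\<lambda>t. (x (i + 1) - x i) / (grid I (i + 1) - grid I i) * (t - grid I i) + x i)"
      by (intro continuous_intros)
    then show "continuous_on {grid I i..grid I (i + 1)} (pw_linear I x)"
      by (rule continuous_on_cong[THEN iffD1, rotated -1]) (use pw_linear_eq[OF I i] in auto)
  qed auto
  then show ?thesis
    by (simp only: grid_cover[OF I])
qed

lemma integrable_pw_linear_diff:
  assumes "2 \<le> I" and "L-lipschitz_on {0..1} f"
  shows "set_integrable lborel {0..1} (\<lambda>t. (pw_linear I x t - f t)\<^sup>2)"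
  using assms
  by (intro borel_integrable_atLeastAtMost' continuous_intros continuous_on_pw_linear
      lipschitz_on_continuous_on)

end

theory Submission
  imports Defs
begin

text \<open>
  Split \<open>pw_linear x - f\<close> into the interpolant of \<open>x - xstar\<close> and the interpolation error of \<open>f\<close>.
  On a cell of length \<open>h\<close>, at the point with relative position \<open>s\<close>, convexity of the square bounds
  the square of the first part by \<open>(1 - s) d\<^sub>i\<^sup>2 + s d\<^sub>i\<^sub>+\<^sub>1\<^sup>2\<close>, and the Lipschitz condition bounds the
  second part by \<open>2 L h s (1 - s)\<close>. With \<open>(u + v)\<^sup>2 \<le> 2 u\<^sup>2 + 2 v\<^sup>2\<close> and \<open>\<integral> s\<^sup>2 (1 - s)\<^sup>2 = 1/30\<close>,
  integrating and summing over the cells gives \<open>2 h \<parallel>x - xstar\<parallel>\<^sup>2 + 4/15 L\<^sup>2 h\<^sup>2\<close>, and each of the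
  two terms is below \<open>\<epsilon>\<^sup>2 / 2\<close>.
\<close>

lemma square_convex_combination_le:
  fixes u v s :: real
  assumes "0 \<le> s" "s \<le> 1"
  shows "((1 - s) * u + s * v)\<^sup>2 \<le> (1 - s) * u\<^sup>2 + s * v\<^sup>2"
proof -
  have "(1 - s) * u\<^sup>2 + s * v\<^sup>2 - ((1 - s) * u + s * v)\<^sup>2 = s * (1 - s) * (u - v)\<^sup>2"
    by (simp add: power2_eq_square algebra_simps)
  moreover have "0 \<le> s * (1 - s) * (u - v)\<^sup>2"
    using assms by simp
  ultimately show ?thesis by linarith
qed

text \<open>Since the weights \<open>1 - s\<close> and \<open>s\<close> add up to 1,
  \<open>f (p + s * h)\<close> can be distributed over the two endpoint values. The endpoint
  differences are at most \<open>L * s * h\<close> and \<open>L * (1 - s) * h\<close>, so after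
  weighting each contributes \<open>L * h * s * (1 - s)\<close>.\<close>

lemma lipschitz_linear_interpolation_error:
  fixes f :: "real \<Rightarrow> real"
  assumes L: "L-lipschitz_on {p..p + h} f" and h: "0 \<le> h" and s: "0 \<le> s" "s \<le> 1"
  shows "\<bar>(1 - s) * f p + s * f (p + h) - f (p + s * h)\<bar> \<le> 2 * L * h * (s * (1 - s))"
proof -
  have t: "0 \<le> s * h" "s * h \<le> h"
    using s h by (auto intro: mult_left_le_one_le)
  have "\<bar>f p - f (p + s * h)\<bar> \<le> L * (s * h)"
    using lipschitz_onD[OF L, of p "p + s * h"] t h by (simp add: dist_real_def)
  moreover have "\<bar>f (p + h) - f (p + s * h)\<bar> \<le> L * (h - s * h)"
    using lipschitz_onD[OF L, of "p + h" "p + s * h"] t h by (simp add: dist_real_def)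
  ultimately have "(1 - s) * \<bar>f p - f (p + s * h)\<bar> + s * \<bar>f (p + h) - f (p + s * h)\<bar>
      \<le> (1 - s) * (L * (s * h)) + s * (L * (h - s * h))"
    using s by (intro add_mono mult_left_mono) auto
  moreover have "\<bar>(1 - s) * (f p - f (p + s * h)) + s * (f (p + h) - f (p + s * h))\<bar>
      \<le> (1 - s) * \<bar>f p - f (p + s * h)\<bar> + s * \<bar>f (p + h) - f (p + s * h)\<bar>"
    using s abs_triangle_ineq[of "(1 - s) * (f p - f (p + s * h))" "s * (f (p + h) - f (p + s * h))"]
    by (simp add: abs_mult)
  ultimately show ?thesis
    by (simp add: algebra_simps)
qed

text \<open>Interpolation is linear in the node values, so the error is \<open>u + v\<close>, where
  \<open>u\<close> interpolates the errors at the nodes and \<open>v\<close> is the interpolation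
  error of \<open>f\<close> itself. The constant 8 is the 2 of
  \<open>(u + v)\<^sup>2 \<le> 2 * u\<^sup>2 + 2 * v\<^sup>2\<close> times the square of the 2 in
  the bound for \<open>v\<close>.\<close>

lemma linear_interpolation_square_error_le:
  fixes f :: "real \<Rightarrow> real"
  assumes L: "L-lipschitz_on {p..p + h} f" and h: "0 \<le> h" and s: "0 \<le> s" "s \<le> 1"
  shows "((1 - s) * a + s * b - f (p + s * h))\<^sup>2
    \<le> 2 * ((1 - s) * (a - f p)\<^sup>2 + s * (b - f (p + h))\<^sup>2) + 8 * (L * h)\<^sup>2 * (s * (1 - s))\<^sup>2"
proof -
  define u where "u = (1 - s) * (a - f p) + s * (b - f (p + h))"
  define v where "v = (1 - s) * f p + s * f (p + h) - f (p + s * h)"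
  have "u\<^sup>2 \<le> (1 - s) * (a - f p)\<^sup>2 + s * (b - f (p + h))\<^sup>2"
    unfolding u_def by (rule square_convex_combination_le[OF s])
  moreover have "v\<^sup>2 \<le> (2 * L * h * (s * (1 - s)))\<^sup>2"
    using power_mono[OF lipschitz_linear_interpolation_error[OF assms], of 2]
    by (simp add: v_def)
  moreover have "(u + v)\<^sup>2 \<le> 2 * u\<^sup>2 + 2 * v\<^sup>2"
    using zero_le_power2[of "u - v"] by (simp add: power2_sum power2_diff)
  moreover have "(2 * L * h * (s * (1 - s)))\<^sup>2 = 4 * ((L * h)\<^sup>2 * (s * (1 - s))\<^sup>2)"
    by (simp add: power_mult_distrib)
  ultimately have "(u + v)\<^sup>2
      \<le> 2 * ((1 - s) * (a - f p)\<^sup>2 + s * (b - f (p + h))\<^sup>2) + 8 * ((L * h)\<^sup>2 * (s * (1 - s))\<^sup>2)"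
    by argo
  moreover have "(1 - s) * a + s * b - f (p + s * h) = u + v"
    by (simp add: u_def v_def algebra_simps)
  ultimately show ?thesis by (simp only: mult.assoc)
qed

text \<open>The pointwise bound is a polynomial in the relative position. Both weights have mean
  1/2, which cancels the factor 2 of the first term, and \<open>8 * (1/30) = 4/15\<close> gives the
  second. The third power of \<open>h\<close> is \<open>(L * h)\<^sup>2\<close> times the length of
  the cell.\<close>

lemma integral_linear_interpolation_square_error_le:
  fixes f :: "real \<Rightarrow> real"
  assumes L: "L-lipschitz_on {p..p + h} f" and h: "0 < h"
  shows "integral {p..p + h} (\<lambda>t. ((b - a) / h * (t - p) + a - f t)\<^sup>2)
    \<le> h * ((a - f p)\<^sup>2 + (b - f (p + h))\<^sup>2) + 4 / 15 * L\<^sup>2 * h ^ 3"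
proof -
  define A B K where "A = (a - f p)\<^sup>2" and "B = (b - f (p + h))\<^sup>2" and "K = 8 * (L * h)\<^sup>2"
  define g where "g t = 2 * ((1 - (t - p) / h) * A + (t - p) / h * B)
    + K * ((t - p) / h * (1 - (t - p) / h))\<^sup>2" for t
  \<comment> \<open>An antiderivative in the relative position \<open>r\<close>; the leading
    \<open>h\<close> cancels the \<open>1 / h\<close> that the chain rule produces for
    \<open>G\<close>. It vanishes at 0, and at 1 the last bracket is 1/3 - 1/2 + 1/5 = 1/30.\<close>
  define P where "P r = h * (2 * (r * A + r\<^sup>2 / 2 * (B - A)) + K * (r ^ 3 / 3 - r ^ 4 / 2 + r ^ 5 / 5))"
    for r
  define G where "G t = P ((t - p) / h)" for t
  have P: "(P has_real_derivative h * (2 * ((1 - r) * A + r * B) + K * (r * (1 - r))\<^sup>2)) (at r)" for r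
    unfolding P_def
    by (auto intro!: derivative_eq_intros simp: field_simps eval_nat_numeral)
  have "(G has_real_derivative g t) (at t within {p..p + h})" for t
  proof -
    have "((\<lambda>t. (t - p) / h) has_real_derivative 1 / h) (at t within {p..p + h})"
      using h by (auto intro!: derivative_eq_intros)
    from DERIV_chain2[OF P this] show ?thesis
      using h by (simp add: G_def[abs_def] g_def)
  qed
  then have int: "(g has_integral G (p + h) - G p) {p..p + h}"
    using h by (intro fundamental_theorem_of_calculus)
      (auto simp: has_real_derivative_iff_has_vector_derivative)
  have "((b - a) / h * (t - p) + a - f t)\<^sup>2 \<le> g t" if "t \<in> {p..p + h}" for t
  proof -
    define s where "s = (t - p) / h"
    have s: "0 \<le> s" "s \<le> 1" "t = p + s * h"
      using that h by (auto simp: s_def field_simps)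
    have "(b - a) / h * (t - p) + a = (1 - s) * a + s * b"
    proof -
      have "(b - a) / h * (t - p) = (b - a) * s"
        by (simp add: s_def)
      also have "\<dots> + a = (1 - s) * a + s * b"
        by (simp add: algebra_simps)
      finally show ?thesis .
    qed
    then show ?thesis
      using linear_interpolation_square_error_le[OF L _ s(1,2), of a b] h
      by (simp add: g_def A_def B_def K_def flip: s_def s(3))
  qed
  moreover have "(\<lambda>t. ((b - a) / h * (t - p) + a - f t)\<^sup>2) integrable_on {p..p + h}"
    by (intro integrable_continuous_real continuous_intros lipschitz_on_continuous_on[OF L])
  ultimately have "integral {p..p + h} (\<lambda>t. ((b - a) / h * (t - p) + a - f t)\<^sup>2)
      \<le> integral {p..p + h} g"
    using int by (intro integral_le) (auto simp: has_integral_integrable)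
  also have "\<dots> = G (p + h) - G p"
    using int by (rule integral_unique)
  also have "\<dots> = h * (A + B) + 4 / 15 * L\<^sup>2 * h ^ 3"
    using h by (simp add: G_def P_def K_def field_simps power2_eq_square power3_eq_cube)
  finally show ?thesis by (simp add: A_def B_def)
qed

text \<open>Passes from single cells to the whole interval by induction on the right end.
  Monotonicity of \<open>a\<close> keeps the breakpoints ordered, so that adjacent integrals combine
  and \<open>g\<close> stays integrable on the initial segments.\<close>

lemma integral_le_sum_subintervals:
  fixes g :: "real \<Rightarrow> real" and a b :: "nat \<Rightarrow> real"
  assumes "m \<le> n" and "mono a" and "g integrable_on {a m..a n}"
    and "\<And>i. i \<in> {m..<n} \<Longrightarrow> integral {a i..a (Suc i)} g \<le> b i"
  shows "integral {a m..a n} g \<le> (\<Sum>i=m..<n. b i)"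
  using assms
proof (induction n rule: dec_induct)
  case base
  show ?case by simp
next
  case (step n)
  have le: "a m \<le> a n" "a n \<le> a (Suc n)"
    using step.hyps \<open>mono a\<close> by (auto intro: monoD)
  have "integral {a m..a (Suc n)} g = integral {a m..a n} g + integral {a n..a (Suc n)} g"
    using le step.prems(2) by (simp add: Henstock_Kurzweil_Integration.integral_combine)
  moreover have "integral {a m..a n} g \<le> (\<Sum>i=m..<n. b i)"
    using step.prems le
    by (intro step.IH) (auto intro: integrable_subinterval_real)
  moreover have "integral {a n..a (Suc n)} g \<le> b n"
    using step by simp
  ultimately show ?case
    using step.hyps by simp
qed

text \<open>The cell bounds are summed. A grid point is an endpoint of at most two cells, whence the
  factor 2; the \<open>I - 1\<close> cells have total length 1, which turns \<open>h ^ 3\<close>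
  into \<open>h\<^sup>2\<close>.\<close>

lemma integral_pw_linear_square_error_le:
  fixes f :: "real \<Rightarrow> real"
  assumes I: "2 \<le> I" and L: "L-lipschitz_on {0..1} f"
  shows "integral {0..1} (\<lambda>t. (pw_linear I x t - f t)\<^sup>2)
    \<le> 2 / (real I - 1) * (\<Sum>i=1..I. (x i - f (grid I i))\<^sup>2) + 4 / 15 * (L / (real I - 1))\<^sup>2"
proof -
  define h where "h = 1 / (real I - 1)"
  define d where "d i = (x i - f (grid I i))\<^sup>2" for i
  have h: "0 < h" and Ih: "(real I - 1) * h = 1"
    using I by (simp_all add: h_def)
  have grid_Suc: "grid I (Suc i) = grid I i + h" for i
    by (simp add: grid_def h_def add_divide_distrib[symmetric])
  have ends: "grid I 1 = 0" "grid I I = 1"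
    using I by (simp_all add: grid_def)
  have mono: "mono (grid I)"
    using grid_le_iff[OF I] by (auto intro: monoI)
  have cell: "integral {grid I i..grid I (Suc i)} (\<lambda>t. (pw_linear I x t - f t)\<^sup>2)
      \<le> h * (d i + d (Suc i)) + 4 / 15 * L\<^sup>2 * h ^ 3" if i: "i \<in> {1..<I}" for i
  proof -
    have "{grid I i..grid I i + h} \<subseteq> {0..1}"
      using grid_cover[OF I] i grid_Suc by fastforce
    then have "L-lipschitz_on {grid I i..grid I i + h} f"
      by (rule lipschitz_on_subset[OF L])
    note integral_linear_interpolation_square_error_le[OF this h, of "x (Suc i)" "x i"]
    \<comment> \<open>The formula for \<open>pw_linear\<close> holds on the closed cell, because the
      pieces of adjacent cells agree at the shared grid point; the integrands therefore coincide
      everywhere on it.\<close>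
    moreover have "integral {grid I i..grid I i + h} (\<lambda>t. (pw_linear I x t - f t)\<^sup>2)
      = integral {grid I i..grid I i + h}
          (\<lambda>t. ((x (Suc i) - x i) / h * (t - grid I i) + x i - f t)\<^sup>2)"
      by (intro integral_cong) (simp add: pw_linear_eq[OF I i] grid_Suc)
    ultimately show ?thesis
      by (simp add: d_def grid_Suc)
  qed
  have "(\<lambda>t. (pw_linear I x t - f t)\<^sup>2) integrable_on {grid I 1..grid I I}"
    unfolding ends by (rule set_borel_integral_eq_integral(1)[OF integrable_pw_linear_diff[OF I L]])
  then have "integral {grid I 1..grid I I} (\<lambda>t. (pw_linear I x t - f t)\<^sup>2)
      \<le> (\<Sum>i=1..<I. h * (d i + d (Suc i)) + 4 / 15 * L\<^sup>2 * h ^ 3)"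
    using I mono cell by (intro integral_le_sum_subintervals) auto
  also have "\<dots> = h * ((\<Sum>i=1..<I. d i) + (\<Sum>i=1..<I. d (Suc i)))
      + ((real I - 1) * h) * (4 / 15 * (L * h)\<^sup>2)"
    using I by (simp add: sum.distrib sum_distrib_left[symmetric] power2_eq_square power3_eq_cube of_nat_diff)
  also have "\<dots> \<le> h * (2 * (\<Sum>i=1..I. d i)) + ((real I - 1) * h) * (4 / 15 * (L * h)\<^sup>2)"
  proof -
    \<comment> \<open>The sum over left endpoints misses \<open>d I\<close> and the one over right
      endpoints misses \<open>d 1\<close>. As \<open>d\<close> is nonnegative, both may be completed
      to all nodes.\<close>
    have "(\<Sum>i=1..<I. d i) \<le> (\<Sum>i=1..I. d i)"
      by (intro sum_mono2) (auto simp: d_def)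
    moreover have "(\<Sum>i=1..<I. d (Suc i)) = (\<Sum>i=Suc 1..<Suc I. d i)"
      by (simp only: sum.shift_bounds_Suc_ivl)
    moreover have "\<dots> \<le> (\<Sum>i=1..I. d i)"
      by (intro sum_mono2) (auto simp: d_def)
    ultimately show ?thesis
      using h by (intro add_right_mono mult_left_mono) auto
  qed
  finally show ?thesis
    unfolding ends Ih by (simp add: d_def h_def)
qed

theorem theorem4p3:
  fixes f :: "real \<Rightarrow> real" and L\<^sub>f C D \<epsilon> :: real
    and I :: nat and x xstar :: "nat \<Rightarrow> real"
  assumes "L\<^sub>f-lipschitz_on {0..1} f"
    and "\<And>i. i \<in> {1..I} \<Longrightarrow> xstar i = f (grid I i)"
    and "\<epsilon> > 0"
    and "C = sqrt (8 / 15) * L\<^sub>f"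
    and "D = L\<^sub>f / sqrt 30"
    and "real I > C * inverse \<epsilon> + 1"
    and "(L2_set (\<lambda>i. x i - xstar i) {1..I})\<^sup>2 < D * \<epsilon>"
  shows "L2_norm01 (\<lambda>t. pw_linear I x t - f t) < \<epsilon>"
proof -
  define h where "h = 1 / (real I - 1)"
  define S where "S = (\<Sum>i=1..I. (x i - f (grid I i))\<^sup>2)"
  have L0: "0 \<le> L\<^sub>f"
    using assms(1) by (rule lipschitz_on_nonneg)
  have "(L2_set (\<lambda>i. x i - xstar i) {1..I})\<^sup>2 = S"
    unfolding L2_set_def S_def by (simp add: sum_nonneg assms(2))
  then have S: "S < D * \<epsilon>" using assms(7) by simp
  \<comment> \<open>The lower bound on \<open>I\<close> is thus at least 1, which forces two grid
    points, so that the spacing \<open>h\<close> is positive and the results on the grid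
    apply.\<close>
  have "0 \<le> C * inverse \<epsilon>"
    using assms(3,4) L0 by simp
  then have I1: "real I > 1" using assms(6) by linarith
  then have I: "2 \<le> I" by simp
  have h: "0 < h" using I1 by (simp add: h_def)
  have Ch: "C * h < \<epsilon>"
    using assms(3,6) I1 by (simp add: h_def field_simps)
  have "(C * h)\<^sup>2 < \<epsilon>\<^sup>2"
    using Ch assms(4) L0 h by (intro power_strict_mono) auto
  \<comment> \<open>\<open>C\<close> is chosen so that \<open>C\<^sup>2\<close> is twice
    \<open>4 / 15 * L\<^sub>f\<^sup>2\<close>.\<close>
  then have interp: "4 / 15 * (L\<^sub>f * h)\<^sup>2 < \<epsilon>\<^sup>2 / 2"
    by (simp add: assms(4) power_mult_distrib)
  \<comment> \<open>This is where the two constants match: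
    \<open>4 / sqrt 30 = sqrt (16 / 30) = sqrt (8 / 15)\<close>.\<close>
  have "4 * D = C"
  proof -
    have "sqrt (8 / 15) = sqrt ((4 * (1 / sqrt 30))\<^sup>2)"
      by (rule arg_cong[of _ _ sqrt]) (simp add: power_mult_distrib power_divide)
    then show ?thesis
      by (simp add: assms(4,5))
  qed
  \<comment> \<open>The assumption bounds the squared norm \<open>S\<close> only linearly in
    \<open>\<epsilon>\<close>; the spacing supplies the second factor through
    \<open>C * h < \<epsilon>\<close>.\<close>
  have "h * S \<le> h * (D * \<epsilon>)"
    using S h by simp
  also have "\<dots> = C * h * \<epsilon> / 4"
    using \<open>4 * D = C\<close> by auto
  also have "\<dots> < \<epsilon>\<^sup>2 / 4"
    using Ch assms(3) by (simp add: power2_eq_square)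
  finally have data: "2 * h * S < \<epsilon>\<^sup>2 / 2" by simp
  have "(LINT t:{0..1}|lborel. (pw_linear I x t - f t)\<^sup>2)
      = integral {0..1} (\<lambda>t. (pw_linear I x t - f t)\<^sup>2)"
    using integrable_pw_linear_diff[OF I assms(1)] by (rule set_borel_integral_eq_integral(2))
  also have "\<dots> \<le> 2 * h * S + 4 / 15 * (L\<^sub>f * h)\<^sup>2"
    using integral_pw_linear_square_error_le[OF I assms(1), of x] by (simp add: h_def S_def)
  also have "\<dots> < \<epsilon>\<^sup>2"
    using interp data by linarith
  finally have "L2_norm01 (\<lambda>t. pw_linear I x t - f t) < sqrt (\<epsilon>\<^sup>2)"
    unfolding L2_norm01_def by (rule real_sqrt_less_mono)
  then show ?thesis
    using assms(3) by simp
qed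

end
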